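(* Let $x_1,\dots,x_n\in\mathcal{X}$ and $y_1,\dots,y_n\in\{-1,+1\}$. For any $h:\mathcal{X}\to\{-1,+1\}$ and any distributions $p,q\in\Delta_n$, $$|\gamma(p)-\gamma(q)|\le\mathrm{TV}(p,q)\le\sqrt{\tfrac12\,\mathrm{KL}(p\,\|\,q)},$$ where $\gamma(\cdot)$ denotes the edge of $h$ under the given distribution.
   Context: $\Delta_n=\{p\in\mathbb{R}^n:p_i\ge0,\ \sum_i p_i=1\}$. The edge of $h$ under $p\in\Delta_n$ is $\gamma(p)=\frac12\sum_{i=1}^n p_i\,y_i h(x_i)=\frac12-\sum_{i=1}^n p_i\,\mathbf{1}[y_i\neq h(x_i)]$. The total variation distance is $\mathrm{TV}(p,q)=\frac12\sum_{i=1}^n|p_i-q_i|$. The Kullback–Leibler divergence is $\mathrm{KL}(p\|q)=\sum_i p_i\log(p_i/q_i)$ (natural logarithm), with $0\log 0=0$ and value $+\infty$ if $p_i>0=q_i$ for some $i$. *)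

theory Defs
  imports "HOL-Analysis.Analysis"
begin

definition prob_simplex :: "(real ^ 'n) set" where
  "prob_simplex = {p. (\<forall>i. 0 \<le> p $ i) \<and> (\<Sum>i\<in>UNIV. p $ i) = 1}"

definition edge :: "('n \<Rightarrow> 'x) \<Rightarrow> ('n \<Rightarrow> real) \<Rightarrow> ('x \<Rightarrow> real) \<Rightarrow> real ^ 'n \<Rightarrow> real" where
  "edge x y h p = 1 / 2 * (\<Sum>i\<in>UNIV. p $ i * y i * h (x i))"

lemma edge_eq_half_minus_error:
  assumes "p \<in> prob_simplex" "\<And>i. y i \<in> {-1, 1}" "\<And>u. h u \<in> {-1, 1}"
  shows "edge x y h p = 1 / 2 - (\<Sum>i\<in>UNIV. p $ i * of_bool (y i \<noteq> h (x i)))"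
proof -
  have "p $ i * y i * h (x i) = p $ i - 2 * (p $ i * of_bool (y i \<noteq> h (x i)))" for i
    using assms(2)[of i] assms(3)[of "x i"] by auto
  then have "(\<Sum>i\<in>UNIV. p $ i * y i * h (x i))
      = 1 - 2 * (\<Sum>i\<in>UNIV. p $ i * of_bool (y i \<noteq> h (x i)))"
    using assms(1) by (simp add: prob_simplex_def sum_subtractf sum_distrib_left del: sum_mult_of_bool_eq)
  then show ?thesis
    by (simp add: edge_def)
qed

definition TV :: "real ^ 'n \<Rightarrow> real ^ 'n \<Rightarrow> real" where
  "TV p q = 1 / 2 * (\<Sum>i\<in>UNIV. \<bar>p $ i - q $ i\<bar>)"

(* In the finite case, terms with p $ i = 0 vanish whatever ln returns at 0
   or p $ i / q $ i at q $ i = 0, which is the convention 0 log 0 = 0. *)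
definition KL :: "real ^ 'n \<Rightarrow> real ^ 'n \<Rightarrow> ereal" where
  "KL p q = (if \<exists>i. 0 < p $ i \<and> q $ i = 0 then \<infinity>
             else ereal (\<Sum>i\<in>UNIV. p $ i * ln (p $ i / q $ i)))"

(* Extends the library's real sqrt, which is odd: a negative argument gives a
   negative value, so that an inequality 0 \<le> sqrt_ereal a still says 0 \<le> a. *)
definition sqrt_ereal :: "ereal \<Rightarrow> ereal" where
  "sqrt_ereal a = (if \<bar>a\<bar> = \<infinity> then a else ereal (sqrt (real_of_ereal a)))"

end

theory Submission
  imports Defs
begin

text \<open>
  For the second inequality (Pinsker's inequality),
  the pointwise bound \<open>3 (p - q)\<^sup>2 \<le> (2 p + 4 q) (p ln (p / q) - p + q)\<close> is combined with the
  Cauchy--Schwarz inequality: the first factors sum up to \<open>6\<close> and the second ones to the divergence.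
\<close>

text \<open>The derivative of the difference is \<open>(t - 1)\<^sup>3 / (t (t + 2))\<^sup>2\<close>, so it is minimal at \<open>t = 1\<close>.\<close>

lemma ln_ge_rational:
  fixes t :: real
  assumes "0 < t"
  shows "(t - 1) * (5 * t + 1) / (2 * t * (t + 2)) \<le> ln t"
proof -
  define g :: "real \<Rightarrow> real" where
    "g t = ln t - (t - 1) * (5 * t + 1) / (2 * t * (t + 2))" for t
  have deriv: "(g has_real_derivative (s - 1) ^ 3 / (s * (s + 2))\<^sup>2) (at s)" if "0 < s" for s
  proof -
    have "((\<lambda>t. (t - 1) * (5 * t + 1)) has_real_derivative 10 * s - 4) (at s)"
      by (auto intro!: derivative_eq_intros)
    moreover have "((\<lambda>t. 2 * t * (t + 2)) has_real_derivative 4 * s + 4) (at s)"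
      by (auto intro!: derivative_eq_intros)
    moreover have "2 * s * (s + 2) \<noteq> 0"
      using that by simp
    ultimately have "(g has_real_derivative 1 / s - ((10 * s - 4) * (2 * s * (s + 2))
        - (s - 1) * (5 * s + 1) * (4 * s + 4)) / ((2 * s * (s + 2)) * (2 * s * (s + 2)))) (at s)"
      unfolding g_def by (intro DERIV_diff DERIV_ln_divide DERIV_divide that)
    \<comment> \<open>The cubic terms cancel in the numerator of the quotient rule, and its factor 4
      cancels against the squared denominator. Over \<open>(s * (s + 2))\<^sup>2\<close> the two
      terms of the derivative then combine into a perfect cube.\<close>
    moreover have "(10 * s - 4) * (2 * s * (s + 2)) - (s - 1) * (5 * s + 1) * (4 * s + 4)
        = 4 * (7 * s\<^sup>2 + s + 1)"
      by algebra
    moreover have "(2 * s * (s + 2)) * (2 * s * (s + 2)) = 4 * (s * (s + 2))\<^sup>2"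
      by algebra
    moreover have "1 / s = s * (s + 2)\<^sup>2 / (s * (s + 2))\<^sup>2"
      using that by (simp add: power2_eq_square)
    moreover have "(s - 1) ^ 3 = s * (s + 2)\<^sup>2 - (7 * s\<^sup>2 + s + 1)"
      by algebra
    ultimately show ?thesis
      by (simp add: diff_divide_distrib del: distrib_left_numeral)
  qed
  \<comment> \<open>As \<open>g 1 = 0\<close>, this is the claim. The odd power gives the derivative
    the sign of \<open>s - 1\<close>.\<close>
  have "g 1 \<le> g t"
  proof (cases "1 \<le> t")
    case True
    show ?thesis
    proof (rule DERIV_nonneg_imp_nondecreasing[OF True])
      fix s :: real
      assume "1 \<le> s"
      then show "\<exists>d. (g has_real_derivative d) (at s) \<and> 0 \<le> d"
        by (intro exI[of _ "(s - 1) ^ 3 / (s * (s + 2))\<^sup>2"]) (simp add: deriv)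
    qed
  next
    case False
    then have "t \<le> 1" by simp
    then show ?thesis
    proof (rule DERIV_nonpos_imp_nonincreasing)
      fix s :: real
      assume "t \<le> s" "s \<le> 1"
      then have "(s - 1) ^ 3 / (s * (s + 2))\<^sup>2 \<le> 0"
        by (intro divide_nonpos_nonneg) (simp_all add: power_le_zero_eq)
      then show "\<exists>d. (g has_real_derivative d) (at s) \<and> d \<le> 0"
        using deriv[of s] \<open>t \<le> s\<close> assms by auto
    qed
  qed
  then show ?thesis by (simp add: g_def)
qed

text \<open>Solving the equality case for the logarithm, with \<open>t = p / q\<close>, yields
  exactly the rational function of \<open>ln_ge_rational\<close>; putting the logarithm back can
  only enlarge the right-hand side. For \<open>p = 0\<close> the claim is 3 q^2 \<le> 4 q^2.\<close>

lemma pinsker_pointwise: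
  fixes p q :: real
  assumes "0 \<le> p" "0 \<le> q" "q = 0 \<Longrightarrow> p = 0"
  shows "3 * (p - q)\<^sup>2 \<le> (2 * p + 4 * q) * (p * ln (p / q) - p + q)"
proof (cases "p = 0")
  case True
  then show ?thesis by (simp add: power2_eq_square)
next
  case False
  with assms have pq: "0 < p" "0 < q" by (auto simp: less_le)
  have "3 * (p - q)\<^sup>2 = (2 * p + 4 * q) *
      (p * ((p / q - 1) * (5 * (p / q) + 1) / (2 * (p / q) * (p / q + 2))) - p + q)"
  proof -
    have "p / q - 1 = (p - q) / q" "5 * (p / q) + 1 = (5 * p + q) / q" "p / q + 2 = (p + 2 * q) / q"
      using pq by (simp_all add: field_simps)
    then have "p * ((p / q - 1) * (5 * (p / q) + 1) / (2 * (p / q) * (p / q + 2)))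
        = (p - q) * (5 * p + q) / (2 * p + 4 * q)"
      using pq by simp
    moreover have "(2 * p + 4 * q) * ((p - q) * (5 * p + q) / (2 * p + 4 * q) - p + q)
        = (p - q) * (5 * p + q) + (2 * p + 4 * q) * (q - p)"
    proof -
      have "k * (c / k - p + q) = c + k * (q - p)" if "k \<noteq> 0" for c k :: real
        using that by (simp add: algebra_simps)
      then show ?thesis using pq by simp
    qed
    moreover have "3 * (p - q)\<^sup>2 = (p - q) * (5 * p + q) + (2 * p + 4 * q) * (q - p)"
      by algebra
    ultimately show ?thesis by simp
  qed
  also have "\<dots> \<le> (2 * p + 4 * q) * (p * ln (p / q) - p + q)"
    using pq ln_ge_rational[of "p / q"]
    by (intro mult_left_mono add_right_mono diff_right_mono) auto
  finally show ?thesis .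
qed

text \<open>The edge is linear in the distribution, with coefficients of modulus at most 1/2, which
  is the factor in \<open>TV\<close>.\<close>

lemma abs_edge_diff_le_TV:
  assumes "\<And>i. \<bar>y i\<bar> \<le> 1" "\<And>u. \<bar>h u\<bar> \<le> 1"
  shows "\<bar>edge x y h p - edge x y h q\<bar> \<le> TV p q"
proof -
  have "\<bar>(p $ i - q $ i) * (y i * h (x i))\<bar> \<le> \<bar>p $ i - q $ i\<bar>" for i
    using assms(1)[of i] assms(2)[of "x i"]
    by (simp add: abs_mult mult_le_one mult_left_le)
  then have "\<bar>\<Sum>i\<in>UNIV. (p $ i - q $ i) * (y i * h (x i))\<bar> \<le> (\<Sum>i\<in>UNIV. \<bar>p $ i - q $ i\<bar>)"
    by (intro order_trans[OF sum_abs] sum_mono)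
  moreover have "edge x y h p - edge x y h q
      = 1 / 2 * (\<Sum>i\<in>UNIV. (p $ i - q $ i) * (y i * h (x i)))"
    by (simp add: edge_def sum_subtractf algebra_simps)
  ultimately show ?thesis
    by (simp only: TV_def abs_mult)
qed

lemma pinsker_finite:
  fixes p q :: "real ^ 'n::finite"
  assumes p: "p \<in> prob_simplex" and q: "q \<in> prob_simplex"
    and ac: "\<And>i. q $ i = 0 \<Longrightarrow> p $ i = 0"
  shows "TV p q \<le> sqrt ((\<Sum>i\<in>UNIV. p $ i * ln (p $ i / q $ i)) / 2)"
proof -
  \<comment> \<open>The 3 of the pointwise bound is absorbed here, so that \<open>a\<close> sums to
    (2 + 4) / 3 = 2.\<close>
  define a where "a i = (2 * p $ i + 4 * q $ i) / 3" for i
  \<comment> \<open>The correction \<open>q $ i - p $ i\<close> makes every term nonnegative, as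
    square roots require, and sums to 0 over the simplex.\<close>
  define b where "b i = p $ i * ln (p $ i / q $ i) - p $ i + q $ i" for i
  have nonneg: "0 \<le> p $ i" "0 \<le> q $ i" for i
    using p q by (auto simp: prob_simplex_def)
  have ab: "(p $ i - q $ i)\<^sup>2 \<le> a i * b i" for i
    using pinsker_pointwise[OF nonneg[of i] ac[of i]] by (simp add: a_def b_def)
  have a0: "0 \<le> a i" for i
    using nonneg by (simp add: a_def)
  \<comment> \<open>Where \<open>a i\<close> is positive, the sign follows from \<open>ab\<close>,
    since \<open>a i * b i\<close> dominates a square.\<close>
  have b0: "0 \<le> b i" for i
  proof (cases "a i = 0")
    case True
    then have "p $ i = 0" "q $ i = 0"
      using nonneg[of i] by (auto simp: a_def)
    then show ?thesis by (simp add: b_def)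
  next
    case False
    then show ?thesis
      using a0[of i] order_trans[OF zero_le_power2 ab[of i]] by (simp add: zero_le_mult_iff)
  qed
  have "\<bar>p $ i - q $ i\<bar> \<le> sqrt (a i) * sqrt (b i)" for i
    using real_sqrt_le_mono[OF ab[of i]] by (simp add: real_sqrt_mult)
  then have "(\<Sum>i\<in>UNIV. \<bar>p $ i - q $ i\<bar>) \<le> (\<Sum>i\<in>UNIV. sqrt (a i) * sqrt (b i))"
    by (rule sum_mono)
  then have "(2 * TV p q)\<^sup>2 \<le> (\<Sum>i\<in>UNIV. sqrt (a i) * sqrt (b i))\<^sup>2"
    by (intro power_mono) (simp_all add: TV_def sum_nonneg)
  also have "\<dots> \<le> (\<Sum>i\<in>UNIV. (sqrt (a i))\<^sup>2) * (\<Sum>i\<in>UNIV. (sqrt (b i))\<^sup>2)"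
    by (rule Cauchy_Schwarz_ineq_sum)
  also have "\<dots> = (\<Sum>i\<in>UNIV. a i) * (\<Sum>i\<in>UNIV. b i)"
    by (simp add: a0 b0)
  also have "(\<Sum>i\<in>UNIV. a i) = 2"
    using p q
    by (simp add: a_def prob_simplex_def sum.distrib flip: sum_divide_distrib sum_distrib_left)
  also have "(\<Sum>i\<in>UNIV. b i) = (\<Sum>i\<in>UNIV. p $ i * ln (p $ i / q $ i))"
    using p q by (simp add: b_def prob_simplex_def sum.distrib sum_subtractf)
  \<comment> \<open>The chain reads 4 TV^2 \<le> 2 KL.\<close>
  finally show ?thesis
    by (intro real_le_rsqrt) (simp add: power_mult_distrib)
qed

theorem lemma5p2:
  fixes x :: "'n::finite \<Rightarrow> 'x" and y :: "'n \<Rightarrow> real"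
    and h :: "'x \<Rightarrow> real" and p q :: "real ^ 'n"
  assumes "\<And>i. y i \<in> {-1, 1}"
    and "\<And>u. h u \<in> {-1, 1}"
    and "p \<in> prob_simplex" and "q \<in> prob_simplex"
  shows "\<bar>edge x y h p - edge x y h q\<bar> \<le> TV p q
    \<and> ereal (TV p q) \<le> sqrt_ereal (ereal (1 / 2) * KL p q)"
proof
  have "\<bar>y i\<bar> \<le> 1" for i using assms(1)[of i] by auto
  moreover have "\<bar>h u\<bar> \<le> 1" for u using assms(2)[of u] by auto
  ultimately show "\<bar>edge x y h p - edge x y h q\<bar> \<le> TV p q"
    by (rule abs_edge_diff_le_TV)
next
  show "ereal (TV p q) \<le> sqrt_ereal (ereal (1 / 2) * KL p q)"
  \<comment> \<open>If \<open>p\<close> charges a null point of \<open>q\<close>, the right-hand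
    side is infinite; otherwise the divergence is the finite sum bounded in
    \<open>pinsker_finite\<close>.\<close>
  proof (cases "\<exists>i. 0 < p $ i \<and> q $ i = 0")
    case True
    then show ?thesis by (simp add: KL_def sqrt_ereal_def)
  next
    case False
    with assms(3) have "p $ i = 0" if "q $ i = 0" for i
      using that by (auto simp: prob_simplex_def order.order_iff_strict)
    with False show ?thesis
      using pinsker_finite[OF assms(3,4)] by (simp add: KL_def sqrt_ereal_def)
  qed
qed

end
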